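(* Let $a_1>a_2>\cdots>a_N>0$. For given sequences $u_i:\tfrac12\mathbb Z+\tfrac14\to\mathbb R$, $1\le i\le N$, consider functions $f_i^k(n_i)$, $1\le i,k\le N$, as solutions of the respective difference equations $$f_i^k(n_i)f_i^k(n_i+\tfrac12)=\begin{cases}u_i(n_i+\frac14)+a_k,&k\le i,\\-\big(u_i(n_i+\frac14)+a_k\big),&k>i.\end{cases}\qquad(\ast)$$ Given a sequence $u_i$, equations $(\ast)$ define the functions $f_i^k$, $k=1,\dots,N$, uniquely by prescribing their values at one point. Then $\boldsymbol x=(x_1,\dots,x_N)$ defined by $$x_k(\boldsymbol n)=\frac{\prod_{j=1}^Nf_j^k(n_j)}{\prod_{i=1}^{k-1}\sqrt{a_i-a_k}\,\prod_{i=k+1}^N\sqrt{a_k-a_i}},\qquad k=1,\dots,N,$$ constitutes a discrete confocal coordinate system. The right-hand sides of equations $(\ast)$ are positive as long as $\boldsymbol x(\boldsymbol n)$ and $\boldsymbol x(\boldsymbol n+\frac12(\boldsymbol e_1+\cdots+\boldsymbol e_N))$ stay in one hyperoctant of $\mathbb R^N$.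
   Context: $\boldsymbol e_i$ is the unit vector of the $i$-th coordinate direction; $\boldsymbol n=(n_1,\dots,n_N)$ with $n_i\in\frac12\mathbb Z$. Discrete coordinate system: a net $\boldsymbol x:(\tfrac12\mathbb Z)^N\supset\mathcal U\to\mathbb R^N$ such that at any $\boldsymbol n\in\mathcal U$ the $N$ discrete tangent vectors, arbitrarily chosen for each $j=1,\dots,N$ among $\boldsymbol x(\boldsymbol n+\boldsymbol e_j)-\boldsymbol x(\boldsymbol n)$ and $\boldsymbol x(\boldsymbol n)-\boldsymbol x(\boldsymbol n-\boldsymbol e_j)$, are linearly independent. Orthogonal net: for each edge $[\boldsymbol n,\boldsymbol n+\boldsymbol e_i]$, all $2^{N-1}$ points $\boldsymbol x(\boldsymbol n+\frac12\boldsymbol\sigma)$ with $\boldsymbol\sigma=(\sigma_1,\dots,\sigma_N)\in\{\pm1\}^N$, $\sigma_i=1$, lie in a hyperplane orthogonal to the line through $\boldsymbol x(\boldsymbol n)$ and $\boldsymbol x(\boldsymbol n+\boldsymbol e_i)$. Discrete confocal coordinate system: a discrete coordinate system which (i) factorizes, $x_k(\boldsymbol n)=g_1^k(n_1)\cdots g_N^k(n_N)$ for $k=1,\dots,N$, with $g_i^k(n_i)\ne0$ and $g_i^k(n_i)-g_i^k(n_i-1)\neq0$; and (ii) is an orthogonal net.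
   Formalization: Added: u_i+a_k never 0; prescribed value nonzero; on the net's domain u_i differs at consecutive quarter points and adjacent u_i, u_j (i≠j) differ. Positivity in one hyperoctant holds up to permuting the u_i, as is if u_1<...<u_N, and persists along one-coordinate steps. *)

theory Defs
  imports "HOL-Analysis.Analysis"
begin

text \<open>The dimension is the cardinality of the index type \<open>'n\<close>; its linear order plays the role of
  the order of the indices \<open>1, \<dots>, N\<close>. The unit vector in the direction \<open>i\<close> is \<open>axis i 1\<close>.\<close>

definition half_ints :: "real set" where
  "half_ints = {m. 2 * m \<in> \<int>}"

definition half_lattice :: "(real ^ 'n) set" where
  "half_lattice = {n. \<forall>i. n $ i \<in> half_ints}"

text \<open>A net on a domain \<open>U\<close> is a function on the whole space of which only the values on \<open>U\<close> matter:
  all conditions below refer only to lattice points belonging to \<open>U\<close>.\<close>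

definition discrete_tangents ::
    "(real ^ 'n) set \<Rightarrow> (real ^ 'n \<Rightarrow> real ^ 'n) \<Rightarrow> real ^ 'n \<Rightarrow> 'n \<Rightarrow> (real ^ 'n) set" where
  "discrete_tangents U x n j =
     {v. n + axis j 1 \<in> U \<and> v = x (n + axis j 1) - x n} \<union>
     {v. n - axis j 1 \<in> U \<and> v = x n - x (n - axis j 1)}"

text \<open>Injectivity is needed because \<^term>\<open>independent\<close> speaks of a set of vectors, not of a family.\<close>

definition discrete_coordinate_system ::
    "(real ^ 'n) set \<Rightarrow> (real ^ 'n \<Rightarrow> real ^ 'n) \<Rightarrow> bool" where
  "discrete_coordinate_system U x \<longleftrightarrow>
     U \<subseteq> half_lattice \<and>
     (\<forall>n\<in>U. \<forall>v. (\<forall>j. v j \<in> discrete_tangents U x n j) \<longrightarrow> inj v \<and> independent (range v))"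

text \<open>With \<open>d\<close> the (nonzero) direction of an edge, the hyperplanes orthogonal to the line spanned by
  this edge are the sets \<open>{y. d \<bullet> y = b}\<close>.\<close>

definition orthogonal_net :: "(real ^ 'n) set \<Rightarrow> (real ^ 'n \<Rightarrow> real ^ 'n) \<Rightarrow> bool" where
  "orthogonal_net U x \<longleftrightarrow>
     (\<forall>n i. n \<in> U \<and> n + axis i 1 \<in> U \<longrightarrow>
        (let d = x (n + axis i 1) - x n in
           d \<noteq> 0 \<and>
           (\<exists>b. \<forall>\<sigma>. (\<forall>j. \<sigma> $ j \<in> {1, - 1}) \<and> \<sigma> $ i = 1 \<and> n + (1/2) *\<^sub>R \<sigma> \<in> U \<longrightarrow>
                x (n + (1/2) *\<^sub>R \<sigma>) \<in> {y. d \<bullet> y = b})))"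

text \<open>Here \<open>g i k\<close> is the factor of the \<open>k\<close>-th component depending on the \<open>i\<close>-th variable. It is
  a function on the projection of \<open>U\<close> to the \<open>i\<close>-th coordinate axis.\<close>

definition factorizes :: "(real ^ 'n) set \<Rightarrow> (real ^ 'n \<Rightarrow> real ^ 'n) \<Rightarrow> bool" where
  "factorizes U x \<longleftrightarrow>
     (\<exists>g :: 'n \<Rightarrow> 'n \<Rightarrow> real \<Rightarrow> real.
        (\<forall>n\<in>U. \<forall>k. x n $ k = (\<Prod>i\<in>UNIV. g i k (n $ i))) \<and>
        (\<forall>i k. \<forall>m \<in> (\<lambda>n. n $ i) ` U.
           g i k m \<noteq> 0 \<and> (m - 1 \<in> (\<lambda>n. n $ i) ` U \<longrightarrow> g i k m - g i k (m - 1) \<noteq> 0)))"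

definition discrete_confocal_coordinate_system ::
    "(real ^ 'n) set \<Rightarrow> (real ^ 'n \<Rightarrow> real ^ 'n) \<Rightarrow> bool" where
  "discrete_confocal_coordinate_system U x \<longleftrightarrow>
     discrete_coordinate_system U x \<and> factorizes U x \<and> orthogonal_net U x"

text \<open>The right-hand side of the difference equation for \<open>f i k\<close>, where \<open>v\<close> is the value of \<open>u i\<close>.\<close>

definition rhs :: "('n :: linorder \<Rightarrow> real) \<Rightarrow> 'n \<Rightarrow> 'n \<Rightarrow> real \<Rightarrow> real" where
  "rhs a i k v = (if k \<le> i then v + a k else - (v + a k))"

definition solves ::
    "('n :: linorder \<Rightarrow> real) \<Rightarrow> ('n \<Rightarrow> real \<Rightarrow> real) \<Rightarrow> 'n \<Rightarrow> 'n \<Rightarrow> (real \<Rightarrow> real) \<Rightarrow> bool" where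
  "solves a u i k h \<longleftrightarrow>
     (\<forall>m\<in>half_ints. h m * h (m + 1/2) = rhs a i k (u i (m + 1/4)))"

definition confocal_net ::
    "('n :: {finite, linorder} \<Rightarrow> real) \<Rightarrow> ('n \<Rightarrow> 'n \<Rightarrow> real \<Rightarrow> real) \<Rightarrow> real ^ ('n :: {finite, linorder}) \<Rightarrow> real ^ ('n :: {finite, linorder})" where
  "confocal_net a f n =
     (\<chi> k. (\<Prod>j\<in>UNIV. f j k (n $ j)) /
           ((\<Prod>i | i < k. sqrt (a i - a k)) * (\<Prod>i | k < i. sqrt (a k - a i))))"

definition hyperoctants :: "(real ^ 'n) set set" where
  "hyperoctants = {{y. \<forall>k. 0 \<le> \<epsilon> k * y $ k} | \<epsilon>. \<forall>k. \<epsilon> k \<in> {1, - 1}}"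

text \<open>The vector \<open>1\<close> in \<open>(1/2) *\<^sub>R 1\<close> is the sum of all unit vectors.\<close>

definition in_one_hyperoctant :: "(real ^ 'n \<Rightarrow> real ^ 'n) \<Rightarrow> real ^ 'n \<Rightarrow> bool" where
  "in_one_hyperoctant x n \<longleftrightarrow> (\<exists>Q\<in>hyperoctants. x n \<in> Q \<and> x (n + (1/2) *\<^sub>R 1) \<in> Q)"

definition all_rhs_pos ::
    "('n :: {finite, linorder} \<Rightarrow> real) \<Rightarrow> ('n \<Rightarrow> real \<Rightarrow> real) \<Rightarrow> real ^ ('n :: {finite, linorder}) \<Rightarrow> bool" where
  "all_rhs_pos a u n \<longleftrightarrow> (\<forall>i k. 0 < rhs a i k (u i (n $ i + 1/4)))"

end

theory Submission
  imports Defs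
begin

text \<open>Write \<open>x\<close> for the net and \<open>w\<^sub>j\<close> for the value of \<open>u j\<close> at the quarter point next to \<open>n $ j\<close> in
  the direction of a sign \<open>\<sigma>\<^sub>j\<close>. Everything follows from two identities. Multiplying the difference
  equations over all directions gives the half step (\<open>x_half_step\<close>)
  \<open>x\<^sub>k(n) x\<^sub>k(n + \<sigma>/2) = (\<Prod>\<^sub>j (w\<^sub>j + a\<^sub>k)) / (\<Prod>\<^sub>j\<^sub>\<noteq>\<^sub>k (a\<^sub>k - a\<^sub>j))\<close>, because
  the square of the normalizing constant carries exactly the signs of the difference equations.
  Combining two half steps in the same direction gives the full step (\<open>x_full_step\<close>): the edge
  vector in the direction \<open>i\<close> has the components \<open>\<Delta>\<^sub>i x\<^sub>k(n) / (w\<^sub>i + a\<^sub>k)\<close>, where \<open>\<Delta>\<^sub>i\<close> is the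
  difference of two neighbouring values of \<open>u i\<close>.

  \<^item> Orthogonality: in the scalar product of the edge vector with the vertex \<open>x(n + \<sigma>/2)\<close>, where
    \<open>\<sigma>\<^sub>i = 1\<close>, the factor \<open>w\<^sub>i + a\<^sub>k\<close> cancels and a Lagrange sum of a
    monic polynomial of degree \<open>N - 1\<close> over the nodes \<open>a\<^sub>k\<close> remains. It equals \<open>1\<close>, so the product is \<open>\<Delta>\<^sub>i\<close> for every such \<open>\<sigma>\<close>
    (\<open>edge_inner_vertex\<close>).
  \<^item> Independence of the tangents: by the full step their matrix is a Cauchy matrix with scaled rows
    and columns, nonsingular as the \<open>w\<^sub>i\<close> are distinct (\<open>tangents_independent\<close>).
  \<^item> Positivity: if both ends of the half step with \<open>\<sigma> = 1\<close> lie in one hyperoctant, then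
    \<open>\<Prod>\<^sub>j (w\<^sub>j + z)\<close> has alternating signs at the nodes \<open>z = a\<^sub>k\<close>, beginning with
    a positive one at the largest node. By parity, each interval between
    neighbouring nodes, and the one below the smallest node, contains exactly one of the zeros
    \<open>- w\<^sub>j\<close> (\<open>prod_rhs_pos_imp_ex_bij\<close>). This is the positivity of all right-hand sides up to a
    permutation of the directions. The permutation is trivial if the \<open>w\<^sub>j\<close> increase with \<open>j\<close>, and
    it stays trivial along a path that changes one coordinate at a time.\<close>

section \<open>Solutions of the difference equation\<close>

lemma half_ints_shift:
  assumes "m \<in> half_ints"
  shows "m + real_of_int k / 2 \<in> half_ints"
proof -
  have "2 * (m + real_of_int k / 2) = 2 * m + of_int k"
    by simp
  then show ?thesis
    using assms by (simp add: half_ints_def)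
qed

lemma half_ints_step:
  assumes "m \<in> half_ints" and "s \<in> {1, - 1}"
  shows "m + s / 2 \<in> half_ints" and "m + s \<in> half_ints"
  using half_ints_shift[OF assms(1), of 1] half_ints_shift[OF assms(1), of "- 1"]
    half_ints_shift[OF assms(1), of 2] half_ints_shift[OF assms(1), of "- 2"] assms(2)
  by auto

lemma half_ints_cases:
  assumes "m0 \<in> half_ints" and "m \<in> half_ints"
  obtains k :: int where "m = m0 + k / 2"
proof -
  have "2 * m - 2 * m0 \<in> \<int>"
    using assms by (simp add: half_ints_def)
  then obtain k :: int where "2 * m - 2 * m0 = k"
    by (auto elim: Ints_cases)
  then have "m = m0 + k / 2"
    by simp
  then show thesis ..
qed

text \<open>The equation determines each of two neighbouring values from the other one, because its
  right-hand side does not vanish; so one value propagates in both directions.\<close>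

lemma product_equation_ex1:
  fixes r :: "real \<Rightarrow> real"
  assumes r: "\<And>m. m \<in> half_ints \<Longrightarrow> r m \<noteq> 0"
    and m0: "m0 \<in> half_ints" and c: "c \<noteq> 0"
  shows "\<exists>!h. h \<in> extensional half_ints \<and>
           (\<forall>m\<in>half_ints. h m * h (m + 1/2) = r m) \<and> h m0 = c"
proof (rule ex_ex1I)
  define R where "R k = r (m0 + real_of_int k / 2)" for k
  have R0: "R k \<noteq> 0" for k
    unfolding R_def using r half_ints_shift m0 by blast
  define F where "F = rec_nat c (\<lambda>n y. R (int n) / y)"
  define G where "G = rec_nat c (\<lambda>n y. R (- int (Suc n)) / y)"
  have F0: "F n \<noteq> 0" for n
    by (induction n) (use c R0 in \<open>auto simp: F_def\<close>)
  have G0: "G n \<noteq> 0" for n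
    by (induction n) (use c R0 in \<open>auto simp: G_def\<close>)
  have FS: "F (Suc n) = R (int n) / F n" and GS: "G (Suc n) = R (- int (Suc n)) / G n" for n
    by (simp_all add: F_def G_def)
  define H where "H k = (if 0 \<le> k then F (nat k) else G (nat (- k)))" for k :: int
  have H: "H k * H (k + 1) = R k" for k
  proof (cases "0 \<le> k")
    case True
    then obtain n where "k = int n"
      using zero_le_imp_eq_int by blast
    then have "H k = F n" "H (k + 1) = F (Suc n)" "R k = R (int n)"
      by (simp_all add: H_def nat_add_distrib)
    then show ?thesis
      using F0[of n] by (simp add: FS)
  next
    case False
    then obtain n where k: "k = - int (Suc n)"
      by (cases k rule: int_cases) auto
    have "H (k + 1) = G n"
    proof (cases "n = 0")
      case True
      then have "k + 1 = 0"
        using k by simp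
      then show ?thesis
        by (simp only: H_def True) (simp add: F_def G_def)
    next
      case False
      then have "\<not> 0 \<le> k + 1" "nat (- (k + 1)) = n"
        using k by linarith+
      then show ?thesis
        by (simp only: H_def if_False)
    qed
    moreover have "H k = G (Suc n)"
    proof -
      have "nat (- k) = Suc n"
        using k by linarith
      then show ?thesis
        by (simp only: H_def False if_False)
    qed
    ultimately show ?thesis
      using G0[of n] by (simp only: GS k) simp
  qed
  define h where "h m = (if m \<in> half_ints then H \<lfloor>2 * (m - m0)\<rfloor> else undefined)" for m
  have h: "h (m0 + real_of_int k / 2) = H k" for k
    using half_ints_shift[OF m0] by (simp add: h_def)
  have "h m * h (m + 1/2) = r m" if m: "m \<in> half_ints" for m
  proof -
    obtain k where k: "m = m0 + real_of_int k / 2"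
      using half_ints_cases m0 m by blast
    have m': "m + 1/2 = m0 + real_of_int (k + 1) / 2"
      by (simp add: k field_simps)
    have "h m = H k"
      unfolding k by (rule h)
    moreover have "h (m + 1/2) = H (k + 1)"
      unfolding m' by (rule h)
    ultimately show ?thesis
      using H[of k] by (simp only: k R_def)
  qed
  moreover have "h m0 = c"
    using h[of 0] by (simp add: H_def F_def)
  moreover have "h \<in> extensional half_ints"
    by (simp add: h_def extensional_def)
  ultimately show "\<exists>h. h \<in> extensional half_ints \<and>
      (\<forall>m\<in>half_ints. h m * h (m + 1/2) = r m) \<and> h m0 = c"
    by (intro exI[of _ h]) simp
next
  fix h h'
  assume "h \<in> extensional half_ints \<and> (\<forall>m\<in>half_ints. h m * h (m + 1/2) = r m) \<and> h m0 = c"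
    and "h' \<in> extensional half_ints \<and> (\<forall>m\<in>half_ints. h' m * h' (m + 1/2) = r m) \<and> h' m0 = c"
  then have ext: "h \<in> extensional half_ints" "h' \<in> extensional half_ints"
    and eq: "\<And>m. m \<in> half_ints \<Longrightarrow> h m * h (m + 1/2) = r m"
      "\<And>m. m \<in> half_ints \<Longrightarrow> h' m * h' (m + 1/2) = r m"
    and init: "h m0 = c" "h' m0 = c"
    by auto
  have up: "h (m0 + real_of_int (k + 1) / 2) = h' (m0 + real_of_int (k + 1) / 2) \<longleftrightarrow>
      h (m0 + real_of_int k / 2) = h' (m0 + real_of_int k / 2)" for k
  proof -
    have m: "m0 + real_of_int k / 2 \<in> half_ints"
      using half_ints_shift m0 by blast
    have m': "m0 + real_of_int (k + 1) / 2 = m0 + real_of_int k / 2 + 1/2"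
      by (simp add: field_simps)
    have "y1 = y2 \<longleftrightarrow> z1 = z2"
      if "z1 * y1 = q" "z2 * y2 = q" "q \<noteq> 0" for y1 y2 z1 z2 q :: real
      using that by auto
    then show ?thesis
      unfolding m' using eq[OF m] r[OF m] by blast
  qed
  have "h (m0 + real_of_int k / 2) = h' (m0 + real_of_int k / 2)" for k
  proof (induction k rule: int_induct[where k = 0])
    case base
    then show ?case
      by (simp add: init)
  next
    case (step1 i)
    then show ?case
      using up[of i] by blast
  next
    case (step2 i)
    then show ?case
      using up[of "i - 1"] by simp
  qed
  then have "h m = h' m" if "m \<in> half_ints" for m
    using half_ints_cases[OF m0 that] by metis
  then show "h = h'"
    using extensionalityI[OF ext] by blast
qed

section \<open>Rational functions with simple poles\<close>

text \<open>The left-hand side is the coefficient of highest possible degree in the Lagrange interpolation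
  polynomial of \<open>p\<close> at the nodes \<open>a k\<close>, and this polynomial is \<open>p\<close> itself.\<close>

lemma sum_poly_over_node_products:
  fixes a :: "'i \<Rightarrow> real"
  assumes fin: "finite S" and inj: "inj_on a S" and deg: "degree p < card S"
  shows "(\<Sum>k\<in>S. poly p (a k) / (\<Prod>j\<in>S - {k}. a k - a j)) = coeff p (card S - 1)"
proof -
  define c where "c k = poly p (a k) / (\<Prod>j\<in>S - {k}. a k - a j)" for k
  define L where "L k = (\<Prod>j\<in>S - {k}. [:- a j, 1:])" for k
  define q where "q = (\<Sum>k\<in>S. smult (c k) (L k))"
  have degL: "degree (L k) = card S - 1" if "k \<in> S" for k
    unfolding L_def using that fin by (subst degree_prod_sum_eq) auto
  have coeffL: "coeff (L k) (card S - 1) = 1" if "k \<in> S" for k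
    using lead_coeff_prod[of "\<lambda>j. [:- a j, 1:]" "S - {k}"] degL[OF that] by (simp add: L_def)
  have L_other: "poly (L k) (a l) = 0" if "l \<in> S" "k \<noteq> l" for k l
    using that fin by (auto simp: L_def poly_prod)
  have L_same: "poly (L k) (a k) = (\<Prod>j\<in>S - {k}. a k - a j)" for k
    by (simp add: L_def poly_prod)
  have nz: "(\<Prod>j\<in>S - {k}. a k - a j) \<noteq> 0" if "k \<in> S" for k
    using that fin inj by (auto simp: inj_on_def)
  have "poly q (a l) = poly p (a l)" if l: "l \<in> S" for l
  proof -
    have "poly q (a l) = (\<Sum>k\<in>S. c k * poly (L k) (a l))"
      by (simp add: q_def poly_sum)
    also have "\<dots> = (\<Sum>k\<in>{l}. c k * poly (L k) (a l))"
      using l fin L_other by (intro sum.mono_neutral_right) auto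
    also have "\<dots> = poly p (a l)"
      using nz[OF l] by (simp add: L_same c_def)
    finally show ?thesis .
  qed
  moreover have "degree q < card S"
  proof -
    have "degree q \<le> card S - 1"
      unfolding q_def using fin degL
      by (intro degree_sum_le) (metis degree_smult_le)+
    then show ?thesis
      using deg by linarith
  qed
  ultimately have "q = p"
    using deg inj by (intro poly_eqI_degree[of "a ` S"]) (auto simp: card_image)
  moreover have "coeff q (card S - 1) = (\<Sum>k\<in>S. c k)"
    unfolding q_def coeff_sum coeff_smult by (intro sum.cong refl) (simp only: coeffL mult_1_right)
  ultimately show ?thesis
    by (simp add: c_def)
qed

text \<open>Nonsingularity of the Cauchy matrix: clearing denominators turns the vanishing sum into a
  polynomial of degree less than the number of its zeros \<open>a k\<close>, and evaluating this polynomial at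
  \<open>- w i\<close> isolates \<open>c i\<close>.\<close>

lemma cauchy_matrix_nonsingular:
  fixes a w c :: "'n :: finite \<Rightarrow> real"
  assumes a: "inj a" and w: "inj w" and nz: "\<And>i k. w i + a k \<noteq> 0"
    and zero: "\<And>k. (\<Sum>i\<in>UNIV. c i / (w i + a k)) = 0"
  shows "c i = 0"
proof -
  define L where "L i = (\<Prod>j\<in>- {i}. [:w j, 1:])" for i
  define q where "q = (\<Sum>i\<in>UNIV. smult (c i) (L i))"
  have degL: "degree (L i) = CARD('n) - 1" for i
    unfolding L_def by (subst degree_prod_sum_eq) (auto simp: Compl_eq_Diff_UNIV)
  have polyL: "poly (L i) z = (\<Prod>j\<in>- {i}. w j + z)" for i z
    by (simp add: L_def poly_prod)
  have "poly q (a k) = 0" for k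
  proof -
    have "poly (L i) (a k) = (\<Prod>j\<in>UNIV. w j + a k) / (w i + a k)" for i
      using nz[of i k] by (simp add: polyL prod.remove[of UNIV i] Compl_eq_Diff_UNIV)
    then have "poly q (a k) = (\<Prod>j\<in>UNIV. w j + a k) * (\<Sum>i\<in>UNIV. c i / (w i + a k))"
      by (simp add: q_def poly_sum sum_distrib_left mult_ac)
    then show ?thesis
      by (simp add: zero)
  qed
  moreover have "degree q < CARD('n)"
  proof -
    have "degree q \<le> CARD('n) - 1"
      unfolding q_def using degL by (intro degree_sum_le) (metis finite degree_smult_le)+
    then show ?thesis
      using zero_less_card_finite[where 'a = 'n] by linarith
  qed
  ultimately have "q = 0"
    using a by (intro poly_eqI_degree[of "range a"]) (auto simp: card_image)
  moreover have "poly q (- w i) = c i * (\<Prod>j\<in>- {i}. w j - w i)"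
  proof -
    have "poly (L j) (- w i) = 0" if "j \<noteq> i" for j
      unfolding polyL using that by (intro prod_zero) auto
    then have "poly q (- w i) = (\<Sum>j\<in>{i}. c j * poly (L j) (- w i))"
      unfolding q_def poly_sum poly_smult by (intro sum.mono_neutral_right) auto
    then show ?thesis
      by (simp add: polyL)
  qed
  moreover have "(\<Prod>j\<in>- {i}. w j - w i) \<noteq> 0"
    using w by (auto simp: inj_def)
  ultimately show ?thesis
    by simp
qed

section \<open>Sign patterns\<close>

lemma rhs_le: "k \<le> i \<Longrightarrow> rhs a i k v = v + a k"
  by (simp add: rhs_def)

lemma rhs_greater: "i < k \<Longrightarrow> rhs a i k v = - (v + a k)"
  by (auto simp: rhs_def dest: leD)

lemma prod_rhs:
  fixes a w :: "'n :: {finite, linorder} \<Rightarrow> real"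
  shows "(\<Prod>j\<in>UNIV. rhs a j k (w j)) = (- 1) ^ card {j. j < k} * (\<Prod>j\<in>UNIV. w j + a k)"
proof -
  have "(\<Prod>j\<in>UNIV. rhs a j k (w j)) = (\<Prod>j\<in>UNIV. (if j < k then - 1 else 1) * (w j + a k))"
    by (intro prod.cong) (auto simp: rhs_def)
  also have "\<dots> = (\<Prod>j\<in>UNIV. if j < k then - 1 else 1) * (\<Prod>j\<in>UNIV. w j + a k)"
    by (rule prod.distrib)
  also have "(\<Prod>j\<in>UNIV. if j < k then - 1 else 1) = (- 1 :: real) ^ card {j. j < k}"
    by (simp add: prod.If_cases)
  finally show ?thesis .
qed

lemma sgn_prod_eq_power_card:
  fixes g :: "'i \<Rightarrow> real"
  assumes "finite S" and "\<And>j. j \<in> S \<Longrightarrow> g j \<noteq> 0"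
  shows "sgn (\<Prod>j\<in>S. g j) = (- 1) ^ card {j \<in> S. g j < 0}"
proof -
  have "sgn (\<Prod>j\<in>S. g j) = (\<Prod>j\<in>S. sgn (g j))"
    by (induction S rule: infinite_finite_induct) (auto simp: sgn_mult)
  also have "\<dots> = (\<Prod>j\<in>S. if g j < 0 then - 1 else 1)"
    using assms(2) by (intro prod.cong) (auto simp: sgn_if)
  also have "\<dots> = (- 1) ^ card {j \<in> S. g j < 0}"
    using assms(1) by (simp add: prod.If_cases Int_def)
  finally show ?thesis .
qed

text \<open>For \<open>k\<close> the larger one of two distinct indices \<open>i\<close> and \<open>j\<close>, the two conditions contradict each
  other. For decreasing \<open>a\<close> the condition for \<open>i\<close> locates \<open>- v\<close> between \<open>a i\<close> and the next smaller
  of the numbers \<open>a k\<close>, and these intervals are disjoint.\<close>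

lemma rhs_pos_index_unique:
  assumes "\<And>k. 0 < rhs a i k v" and "\<And>k. 0 < rhs a j k v"
  shows "i = j"
proof (rule ccontr)
  assume "i \<noteq> j"
  then consider "i < j" | "j < i"
    by (meson linorder_neqE)
  then show False
  proof cases
    case 1
    then show False
      using assms(1)[of j] assms(2)[of j] by (simp add: rhs_le rhs_greater)
  next
    case 2
    then show False
      using assms(1)[of i] assms(2)[of i] by (simp add: rhs_le rhs_greater)
  qed
qed

text \<open>The numbers \<open>- w j\<close> are the zeros of the polynomial \<open>\<Prod>j. w j + z\<close>. The hypothesis says that
  this polynomial changes sign from each node \<open>a k\<close> to the next, and from the smallest node to
  minus infinity. So each of these \<open>N\<close> intervals contains an odd number of the \<open>N\<close> zeros, hence
  exactly one.\<close>

lemma prod_rhs_pos_imp_ex_bij: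
  fixes a w :: "'n :: {finite, linorder} \<Rightarrow> real"
  assumes dec: "\<And>i j. i < j \<Longrightarrow> a j < a i"
    and nz: "\<And>j k. w j + a k \<noteq> 0"
    and pos: "\<And>k. 0 < (\<Prod>j\<in>UNIV. rhs a j k (w j))"
  shows "\<exists>\<pi>. bij \<pi> \<and> (\<forall>i k. 0 < rhs a i k (w (\<pi> i)))"
proof -
  define A where "A k = {j. w j + a k < 0}" for k
  have mono: "a l \<le> a k" if "k \<le> l" for k l
    using dec[of k l] that by (cases "k = l") (auto simp: order_le_less)
  have parity: "even (card {j. j < k}) = even (card (A k))" for k
  proof -
    have "1 = sgn (\<Prod>j\<in>UNIV. rhs a j k (w j))"
      using pos[of k] by simp
    also have "\<dots> = (- 1) ^ card {j. j < k} * (- 1) ^ card (A k)"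
      using sgn_prod_eq_power_card[of UNIV "\<lambda>j. w j + a k"] nz
      by (simp add: prod_rhs sgn_mult A_def power_sgn[symmetric])
    also have "\<dots> = (- 1) ^ (card {j. j < k} + card (A k))"
      by (simp add: power_add)
    finally show ?thesis
      by (metis even_add minus_one_power_iff one_neq_neg_one)
  qed
  define B where "B i = {j. \<forall>k. 0 < rhs a i k (w j)}" for i
  have "B i \<noteq> {}" for i
  proof -
    define A' where "A' = {j. \<forall>k>i. w j + a k < 0}"
    have sub: "A i \<subseteq> A'"
    proof
      fix j assume "j \<in> A i"
      then have "w j + a k < 0" if "i < k" for k
        using dec[OF that] by (simp add: A_def)
      then show "j \<in> A'"
        by (simp add: A'_def)
    qed
    have B: "B i = A' - A i"
    proof (intro equalityI subsetI)
      fix j assume j: "j \<in> B i"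
      then have "0 < rhs a i i (w j)" and "0 < rhs a i k (w j)" for k
        unfolding B_def by blast+
      then show "j \<in> A' - A i"
        unfolding A_def A'_def rhs_def
        by (smt (verit) DiffI mem_Collect_eq order.refl not_le)
    next
      fix j assume j: "j \<in> A' - A i"
      then have "0 < w j + a i"
        using nz[of j i] by (auto simp: A_def)
      then have "0 < rhs a i k (w j)" for k
        using j mono[of k i] by (force simp: rhs_def A'_def not_le)
      then show "j \<in> B i"
        by (simp add: B_def)
    qed
    have "even (card A') = even (card {j. j \<le> i})"
    proof (cases "\<exists>k. i < k")
      case False
      then have "\<not> i < k" for k
        by blast
      then have "A' = UNIV" "{j. j \<le> i} = UNIV"
        by (auto simp: A'_def not_less[symmetric] simp del: not_less)
      then show ?thesis
        by simp
    next
      case True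
      define l where "l = Min {k. i < k}"
      have l: "i < l" "\<And>k. i < k \<Longrightarrow> l \<le> k"
        using Min_in[of "{k. i < k}"] True by (auto simp: l_def)
      have "A' = A l"
        unfolding A_def A'_def using l mono by fastforce
      moreover have "{j. j \<le> i} = {j. j < l}"
        using l by (force simp: not_le[symmetric])
      ultimately show ?thesis
        using parity[of l] by simp
    qed
    moreover have "card {j. j \<le> i} = Suc (card {j. j < i})"
    proof -
      have "{j. j \<le> i} = insert i {j. j < i}"
        by auto
      then show ?thesis
        by simp
    qed
    ultimately have "card A' \<noteq> card (A i)"
      using parity[of i] by (metis even_Suc)
    then have "\<not> A' \<subseteq> A i"
      using sub by (metis subset_antisym)
    then show ?thesis
      using B by auto
  qed
  then have "\<exists>\<pi>. \<forall>i. \<pi> i \<in> B i"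
    by (intro choice) blast
  then obtain \<pi> where \<pi>: "\<And>i. \<pi> i \<in> B i"
    by blast
  have "inj \<pi>"
  proof (rule injI)
    fix i j assume "\<pi> i = \<pi> j"
    then show "i = j"
      using \<pi>[of i] \<pi>[of j] rhs_pos_index_unique[of a i "w (\<pi> i)" j] by (simp add: B_def)
  qed
  then have "bij \<pi>"
    by (simp add: bij_def finite_UNIV_inj_surj)
  moreover have "\<forall>i k. 0 < rhs a i k (w (\<pi> i))"
    using \<pi> by (simp add: B_def)
  ultimately show ?thesis
    by blast
qed

lemma strict_mono_bij_imp_id:
  fixes \<pi> :: "'n :: {finite, linorder} \<Rightarrow> 'n"
  assumes bij: "bij \<pi>" and mono: "strict_mono \<pi>"
  shows "\<pi> i = i"
proof (rule ccontr)
  assume "\<pi> i \<noteq> i"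
  define l where "l = Min {i. \<pi> i \<noteq> i}"
  have l: "\<pi> l \<noteq> l"
    using Min_in[of "{i. \<pi> i \<noteq> i}"] \<open>\<pi> i \<noteq> i\<close> by (auto simp: l_def)
  have below: "\<pi> j = j" if "j < l" for j
    using Min_le[of "{i. \<pi> i \<noteq> i}" j] leD[of l j] that unfolding l_def by fastforce
  obtain j where j: "\<pi> j = l"
    using bij by (metis bij_pointE)
  have "l < j"
    using j l below by (metis linorder_neqE)
  then have "\<pi> l < l"
    using mono j by (metis strict_mono_def)
  then have "\<pi> (\<pi> l) = \<pi> l"
    using below by blast
  then show False
    using l bij by (metis bij_is_inj injD)
qed

text \<open>A value found at a larger index is larger, so a bijection that sorts increasing values
  preserves the order.\<close>

lemma rhs_pos_of_bij_sorted:
  fixes a w :: "'n :: {finite, linorder} \<Rightarrow> real"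
  assumes "bij \<pi>" and pos: "\<And>i k. 0 < rhs a i k (w (\<pi> i))"
    and sorted: "\<And>i j. i < j \<Longrightarrow> w i < w j"
  shows "0 < rhs a i k (w i)"
proof -
  have "\<pi> i < \<pi> j" if "i < j" for i j
  proof -
    have "w (\<pi> i) < w (\<pi> j)"
      using pos[of i j] pos[of j j] that by (simp add: rhs_le rhs_greater)
    then show ?thesis
      using sorted[of "\<pi> j" "\<pi> i"] by (metis linorder_neqE not_less_iff_gr_or_eq)
  qed
  then have "strict_mono \<pi>"
    by (simp add: strict_mono_def)
  then have "\<pi> i = i"
    using strict_mono_bij_imp_id \<open>bij \<pi>\<close> by blast
  then show ?thesis
    using pos[of i k] by simp
qed

text \<open>A value that lies in the interval of its own index is assigned to this index by the bijection,
  because the intervals are disjoint. If this holds for all indices but one, the last one is fixed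
  as well.\<close>

lemma rhs_pos_of_bij_all_but_one:
  fixes a w :: "'n :: {finite, linorder} \<Rightarrow> real"
  assumes "bij \<pi>" and pos: "\<And>i k. 0 < rhs a i k (w (\<pi> i))"
    and others: "\<And>j k. j \<noteq> l \<Longrightarrow> 0 < rhs a j k (w j)"
  shows "0 < rhs a i k (w i)"
proof -
  have fixed: "\<pi> j = j" if "j \<noteq> l" for j
  proof -
    obtain j' where j': "\<pi> j' = j"
      using \<open>bij \<pi>\<close> by (metis bij_pointE)
    then have "j' = j"
      using pos[of j'] others[OF that] rhs_pos_index_unique[of a j' "w j" j] by simp
    then show ?thesis
      using j' by simp
  qed
  obtain j where "\<pi> j = l"
    using \<open>bij \<pi>\<close> by (metis bij_pointE)
  then have "\<pi> l = l"
    using fixed by metis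
  then have "\<pi> i = i"
    using fixed by metis
  then show ?thesis
    using pos[of i k] by simp
qed

section \<open>The confocal net\<close>

locale confocal_solution =
  fixes a :: "'n :: {finite, linorder} \<Rightarrow> real"
    and u :: "'n \<Rightarrow> real \<Rightarrow> real"
    and f :: "'n \<Rightarrow> 'n \<Rightarrow> real \<Rightarrow> real"
  assumes a_decreasing: "\<And>i j. i < j \<Longrightarrow> a j < a i"
    and rhs_nonzero: "\<And>i k m. m \<in> half_ints \<Longrightarrow> u i (m + 1/4) + a k \<noteq> 0"
    and solves: "\<And>i k. solves a u i k (f i k)"
begin

abbreviation "x \<equiv> confocal_net a f"

definition normalizer :: "'n \<Rightarrow> real"
  where "normalizer k = (\<Prod>i | i < k. sqrt (a i - a k)) * (\<Prod>i | k < i. sqrt (a k - a i))"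

lemma x_nth: "x n $ k = (\<Prod>j\<in>UNIV. f j k (n $ j)) / normalizer k"
  by (simp add: confocal_net_def normalizer_def)

lemma inj_a: "inj a"
  using a_decreasing by (metis injI linorder_neqE order_less_irrefl)

lemma normalizer_pos: "0 < normalizer k"
  unfolding normalizer_def using a_decreasing by (intro mult_pos_pos prod_pos) auto

lemma normalizer_square:
  "(normalizer k)\<^sup>2 = (- 1) ^ card {j. j < k} * (\<Prod>j\<in>- {k}. a k - a j)"
proof -
  have "(normalizer k)\<^sup>2 = (\<Prod>i | i < k. a i - a k) * (\<Prod>i | k < i. a k - a i)"
    unfolding normalizer_def power_mult_distrib
    by (intro arg_cong2[of _ _ _ _ "(*)"])
      (auto simp: prod_power_distrib intro!: prod.cong real_sqrt_pow2 less_imp_le a_decreasing)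
  also have "(\<Prod>i | i < k. a i - a k) = (- 1) ^ card {j. j < k} * (\<Prod>i | i < k. a k - a i)"
    using prod_uminus[of "\<lambda>i. a k - a i" "{i. i < k}"] by simp
  also have "\<dots> * (\<Prod>i | k < i. a k - a i) =
      (- 1) ^ card {j. j < k} * (\<Prod>j\<in>{i. i < k} \<union> {i. k < i}. a k - a j)"
    by (subst prod.union_disjoint) auto
  also have "{i. i < k} \<union> {i. k < i} = - {k}"
    by auto
  finally show ?thesis .
qed

lemma u_plus_a_nonzero:
  assumes "m \<in> half_ints" and "s \<in> {1, - 1}"
  shows "u i (m + s / 4) + a k \<noteq> 0"
  using rhs_nonzero[OF assms(1)] rhs_nonzero[OF half_ints_step(1)[OF assms(1), of "- 1"]] assms(2)
  by auto

lemma f_half_step: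
  assumes "m \<in> half_ints" and "s \<in> {1, - 1}"
  shows "f i k m * f i k (m + s / 2) = rhs a i k (u i (m + s / 4))"
proof -
  have eq: "f i k m * f i k (m + 1/2) = rhs a i k (u i (m + 1/4))" if "m \<in> half_ints" for m
    using solves that by (simp add: solves_def)
  show ?thesis
    using assms(2) eq[OF assms(1)] eq[OF half_ints_step(1)[OF assms(1), of "- 1"]]
    by (auto simp: mult.commute)
qed

lemma f_nonzero:
  assumes "m \<in> half_ints"
  shows "f i k m \<noteq> 0"
proof
  assume "f i k m = 0"
  then have "rhs a i k (u i (m + 1/4)) = 0"
    using f_half_step[OF assms, of 1 i k] by simp
  then show False
    using rhs_nonzero[OF assms, of i k] by (simp add: rhs_def split: if_splits)
qed

text \<open>Two consecutive half steps share the value of \<open>f\<close> at the midpoint.\<close>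

lemma f_full_step:
  assumes "m \<in> half_ints" and "s \<in> {1, - 1}"
  shows "f i k (m + s) * (u i (m + s / 4) + a k) = f i k m * (u i (m + 3 * s / 4) + a k)"
proof -
  have "m + s / 2 + s / 2 = m + s"
    by simp
  then have "f i k (m + s) * (f i k m * f i k (m + s / 2)) =
      f i k m * (f i k (m + s / 2) * f i k (m + s / 2 + s / 2))"
    by (simp only: mult_ac)
  also have "f i k (m + s / 2) * f i k (m + s / 2 + s / 2) = rhs a i k (u i (m + s / 2 + s / 4))"
    using f_half_step[OF half_ints_step(1)[OF assms] assms(2)] .
  also have "m + s / 2 + s / 4 = m + 3 * s / 4"
    by simp
  finally have "f i k (m + s) * rhs a i k (u i (m + s / 4)) =
      f i k m * rhs a i k (u i (m + 3 * s / 4))"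
    by (simp only: f_half_step[OF assms])
  then show ?thesis
    by (cases "k \<le> i") (simp_all add: rhs_def algebra_simps)
qed

lemma half_lattice_nth: "n \<in> half_lattice \<Longrightarrow> n $ i \<in> half_ints"
  by (simp add: half_lattice_def)

lemma x_nonzero: "n \<in> half_lattice \<Longrightarrow> x n $ k \<noteq> 0"
  using normalizer_pos[of k] by (simp add: x_nth f_nonzero half_lattice_nth)

lemma x_half_step_rhs:
  assumes "n \<in> half_lattice" and "\<And>j. \<sigma> $ j \<in> {1, - 1}"
  shows "x n $ k * x (n + (1/2) *\<^sub>R \<sigma>) $ k =
    (\<Prod>j\<in>UNIV. rhs a j k (u j (n $ j + \<sigma> $ j / 4))) / (normalizer k)\<^sup>2"
proof -
  have "f j k (n $ j) * f j k ((n + (1/2) *\<^sub>R \<sigma>) $ j) = rhs a j k (u j (n $ j + \<sigma> $ j / 4))" for j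
    using f_half_step[OF half_lattice_nth[OF assms(1)] assms(2), of j k j] by simp
  then show ?thesis
    by (simp add: x_nth power2_eq_square prod.distrib[symmetric])
qed

text \<open>The signs \<open>(- 1) ^ card {j. j < k}\<close> from the right-hand sides and from the square of the
  normalizing constant cancel.\<close>

lemma x_half_step:
  assumes "n \<in> half_lattice" and "\<And>j. \<sigma> $ j \<in> {1, - 1}"
  shows "x n $ k * x (n + (1/2) *\<^sub>R \<sigma>) $ k =
    (\<Prod>j\<in>UNIV. u j (n $ j + \<sigma> $ j / 4) + a k) / (\<Prod>j\<in>- {k}. a k - a j)"
  unfolding x_half_step_rhs[OF assms] prod_rhs normalizer_square by simp

lemma x_full_step:
  assumes n: "n \<in> half_lattice" and s: "s \<in> {1, - 1}"
  shows "(x (n + s *\<^sub>R axis i 1) - x n) $ k =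
    (u i (n $ i + 3 * s / 4) - u i (n $ i + s / 4)) * (x n $ k / (u i (n $ i + s / 4) + a k))"
proof -
  let ?v = "u i (n $ i + s / 4)" and ?w = "u i (n $ i + 3 * s / 4)"
  let ?P = "\<Prod>j\<in>- {i}. f j k (n $ j)"
  have nz: "?v + a k \<noteq> 0"
    using u_plus_a_nonzero half_lattice_nth n s by blast
  have x0: "x n $ k = f i k (n $ i) * ?P / normalizer k"
    by (simp add: x_nth prod.remove[of UNIV i] Compl_eq_Diff_UNIV)
  have x1: "x (n + s *\<^sub>R axis i 1) $ k = f i k (n $ i + s) * ?P / normalizer k"
    by (simp add: x_nth prod.remove[of UNIV i] Compl_eq_Diff_UNIV axis_def)
  have "x (n + s *\<^sub>R axis i 1) $ k * (?v + a k) = x n $ k * (?w + a k)"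
    using arg_cong[OF f_full_step[OF half_lattice_nth[OF n] s, of i k i],
        of "\<lambda>y. y * (?P / normalizer k)"]
    by (simp add: x0 x1 mult_ac)
  then have "x (n + s *\<^sub>R axis i 1) $ k = x n $ k * (?w + a k) / (?v + a k)"
    using nz by (simp add: eq_divide_eq)
  then show ?thesis
    using nz by (simp add: field_simps)
qed

subsection \<open>Orthogonality\<close>

text \<open>In the scalar product the factor \<open>u i (n $ i + 1/4) + a k\<close> from the half step cancels against
  the denominator from the full step. What remains is a sum over the nodes \<open>a k\<close> of the values of
  a monic polynomial of degree \<open>N - 1\<close>, so it does not depend on \<open>\<sigma>\<close>.\<close>

lemma edge_inner_vertex:
  assumes n: "n \<in> half_lattice" and \<sigma>: "\<And>j. \<sigma> $ j \<in> {1, - 1}" and \<sigma>i: "\<sigma> $ i = 1"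
  shows "(x (n + axis i 1) - x n) \<bullet> x (n + (1/2) *\<^sub>R \<sigma>) = u i (n $ i + 3/4) - u i (n $ i + 1/4)"
proof -
  let ?\<Delta> = "u i (n $ i + 3/4) - u i (n $ i + 1/4)"
  define w where "w j = u j (n $ j + \<sigma> $ j / 4)" for j
  define p where "p = (\<Prod>j\<in>- {i}. [:w j, 1:])"
  have deg: "degree p = CARD('n) - 1"
    unfolding p_def by (subst degree_prod_sum_eq) (auto simp: Compl_eq_Diff_UNIV)
  have "(x (n + axis i 1) - x n) $ k * x (n + (1/2) *\<^sub>R \<sigma>) $ k =
      ?\<Delta> * (poly p (a k) / (\<Prod>j\<in>UNIV - {k}. a k - a j))" for k
  proof -
    have wi: "w i = u i (n $ i + 1/4)"
      by (simp add: w_def \<sigma>i)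
    have nz: "w i + a k \<noteq> 0"
      unfolding wi using rhs_nonzero half_lattice_nth n by blast
    have "(x (n + axis i 1) - x n) $ k * x (n + (1/2) *\<^sub>R \<sigma>) $ k =
        ?\<Delta> / (w i + a k) * (x n $ k * x (n + (1/2) *\<^sub>R \<sigma>) $ k)"
      using x_full_step[OF n, of 1 i k] by (simp add: wi)
    also have "x n $ k * x (n + (1/2) *\<^sub>R \<sigma>) $ k =
        (\<Prod>j\<in>UNIV. w j + a k) / (\<Prod>j\<in>UNIV - {k}. a k - a j)"
      using x_half_step[OF n \<sigma>] by (simp add: w_def Compl_eq_Diff_UNIV)
    also have "(\<Prod>j\<in>UNIV. w j + a k) = (w i + a k) * poly p (a k)"
      by (simp add: p_def poly_prod prod.remove[of UNIV i] Compl_eq_Diff_UNIV)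
    finally show ?thesis
      using nz by simp
  qed
  then have "(x (n + axis i 1) - x n) \<bullet> x (n + (1/2) *\<^sub>R \<sigma>) =
      ?\<Delta> * (\<Sum>k\<in>UNIV. poly p (a k) / (\<Prod>j\<in>UNIV - {k}. a k - a j))"
    by (simp add: inner_vec_def sum_distrib_left)
  also have "(\<Sum>k\<in>UNIV. poly p (a k) / (\<Prod>j\<in>UNIV - {k}. a k - a j)) = coeff p (CARD('n) - 1)"
    using inj_a deg by (intro sum_poly_over_node_products) auto
  also have "\<dots> = 1"
    using lead_coeff_prod[of "\<lambda>j. [:w j, 1:]" "- {i}"] deg by (simp add: p_def)
  finally show ?thesis
    by simp
qed

lemma orthogonal_net_x:
  assumes U: "U \<subseteq> half_lattice"
    and step: "\<And>n i. n \<in> U \<Longrightarrow> n + axis i 1 \<in> U \<Longrightarrow> u i (n $ i + 3/4) \<noteq> u i (n $ i + 1/4)"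
  shows "orthogonal_net U x"
  unfolding orthogonal_net_def Let_def
proof (intro allI impI conjI)
  fix n i
  assume n: "n \<in> U \<and> n + axis i 1 \<in> U"
  then have lat: "n \<in> half_lattice"
    using U by blast
  let ?\<Delta> = "u i (n $ i + 3/4) - u i (n $ i + 1/4)"
  have \<Delta>: "?\<Delta> \<noteq> 0"
    using step n by simp
  show "x (n + axis i 1) - x n \<noteq> 0"
    \<comment> \<open>The scalar product with the vertex for \<open>\<sigma> = 1\<close> does not vanish.\<close>
    using edge_inner_vertex[OF lat, of 1 i] \<Delta> by auto
  show "\<exists>b. \<forall>\<sigma>. (\<forall>j. \<sigma> $ j \<in> {1, - 1}) \<and> \<sigma> $ i = 1 \<and> n + (1/2) *\<^sub>R \<sigma> \<in> U \<longrightarrow>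
      x (n + (1/2) *\<^sub>R \<sigma>) \<in> {y. (x (n + axis i 1) - x n) \<bullet> y = b}"
    using edge_inner_vertex[OF lat] by (intro exI[of _ ?\<Delta>]) auto
qed

subsection \<open>Linear independence of the discrete tangents\<close>

text \<open>Up to nonzero factors of the rows and columns, the matrix of the tangent vectors is the Cauchy
  matrix with the entries \<open>1 / (w i + a k)\<close>.\<close>

lemma tangents_independent:
  assumes n: "n \<in> half_lattice"
    and s: "\<And>i. s i \<in> {1, - 1}"
    and step: "\<And>i. u i (n $ i + 3 * s i / 4) \<noteq> u i (n $ i + s i / 4)"
    and distinct: "\<And>i j. i \<noteq> j \<Longrightarrow> u i (n $ i + s i / 4) \<noteq> u j (n $ j + s j / 4)"
    and v: "\<And>i. v i = s i *\<^sub>R (x (n + s i *\<^sub>R axis i 1) - x n)"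
  shows "inj v \<and> independent (range v)"
proof -
  define w where "w i = u i (n $ i + s i / 4)" for i
  define \<delta> where "\<delta> i = s i * (u i (n $ i + 3 * s i / 4) - w i)" for i
  have \<delta>: "\<delta> i \<noteq> 0" for i
    using step[of i] s[of i] by (auto simp: \<delta>_def w_def)
  have nz: "w i + a k \<noteq> 0" for i k
    unfolding w_def using u_plus_a_nonzero half_lattice_nth n s by blast
  have v_nth: "v i $ k = x n $ k * (\<delta> i / (w i + a k))" for i k
    using x_full_step[OF n s, of i i k] by (simp add: v \<delta>_def w_def)
  have indep: "c i = 0" if "(\<Sum>i\<in>UNIV. c i *\<^sub>R v i) = 0" for c :: "'n \<Rightarrow> real" and i
  proof -
    have "(\<Sum>i\<in>UNIV. c i * \<delta> i / (w i + a k)) = 0" for k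
    proof -
      have "0 = (\<Sum>i\<in>UNIV. c i *\<^sub>R v i) $ k"
        by (simp add: that)
      also have "\<dots> = x n $ k * (\<Sum>i\<in>UNIV. c i * \<delta> i / (w i + a k))"
        by (simp add: v_nth sum_distrib_left mult_ac)
      finally show ?thesis
        using x_nonzero[OF n] by simp
    qed
    moreover have "inj w"
      using distinct by (auto simp: inj_def w_def)
    ultimately have "c i * \<delta> i = 0"
      using cauchy_matrix_nonsingular[of a w "\<lambda>i. c i * \<delta> i"] inj_a nz by blast
    then show ?thesis
      using \<delta> by simp
  qed
  have inj: "inj v"
  proof (rule injI, rule ccontr)
    fix i j assume eq: "v i = v j" and ne: "i \<noteq> j"
    have "(\<Sum>l\<in>UNIV. ((if l = i then 1 else 0) - (if l = j then 1 else 0)) *\<^sub>R v l) = v i - v j"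
      by (simp add: scaleR_left_diff_distrib sum_subtractf if_distrib[of "\<lambda>r. r *\<^sub>R _"] cong: if_cong)
    then show False
      using indep[of "\<lambda>l. (if l = i then 1 else 0) - (if l = j then 1 else 0)" i] eq ne by simp
  qed
  moreover have "independent (range v)"
  proof (rule independent_if_scalars_zero)
    fix c y
    assume sum: "(\<Sum>y\<in>range v. c y *\<^sub>R y) = 0" and y: "y \<in> range v"
    have "(\<Sum>i\<in>UNIV. c (v i) *\<^sub>R v i) = 0"
      using sum by (simp add: sum.reindex[OF inj])
    then have "c (v i) = 0" for i
      using indep[of "\<lambda>i. c (v i)"] by blast
    then show "c y = 0"
      using y by auto
  qed simp
  ultimately show ?thesis ..
qed

lemma discrete_coordinate_system_x:
  assumes U: "U \<subseteq> half_lattice"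
    and step: "\<And>n i s. n \<in> U \<Longrightarrow> s \<in> {1, - 1} \<Longrightarrow> n + s *\<^sub>R axis i 1 \<in> U \<Longrightarrow>
      u i (n $ i + 3 * s / 4) \<noteq> u i (n $ i + s / 4)"
    and distinct: "\<And>n i j s t. n \<in> U \<Longrightarrow> s \<in> {1, - 1} \<Longrightarrow> t \<in> {1, - 1} \<Longrightarrow> i \<noteq> j \<Longrightarrow>
      n + s *\<^sub>R axis i 1 \<in> U \<Longrightarrow> n + t *\<^sub>R axis j 1 \<in> U \<Longrightarrow>
      u i (n $ i + s / 4) \<noteq> u j (n $ j + t / 4)"
  shows "discrete_coordinate_system U x"
  unfolding discrete_coordinate_system_def
proof (intro conjI U ballI allI impI)
  fix n v
  assume n: "n \<in> U" and v: "\<forall>j. v j \<in> discrete_tangents U x n j"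
  have "\<exists>s. s \<in> {1, - 1} \<and> n + s *\<^sub>R axis j 1 \<in> U \<and>
      v j = s *\<^sub>R (x (n + s *\<^sub>R axis j 1) - x n)" for j
  proof -
    have "v j \<in> discrete_tangents U x n j"
      using v by blast
    then show ?thesis
      unfolding discrete_tangents_def
    proof (elim UnE CollectE conjE)
      assume "n + axis j 1 \<in> U" "v j = x (n + axis j 1) - x n"
      then show ?thesis
        by (intro exI[of _ 1]) simp
    next
      assume "n - axis j 1 \<in> U" "v j = x n - x (n - axis j 1)"
      then show ?thesis
        by (intro exI[of _ "- 1"]) simp
    qed
  qed
  then obtain s where s: "\<And>j. s j \<in> {1, - 1}" "\<And>j. n + s j *\<^sub>R axis j 1 \<in> U"
    "\<And>j. v j = s j *\<^sub>R (x (n + s j *\<^sub>R axis j 1) - x n)"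
    by metis
  have "inj v \<and> independent (range v)"
  proof (rule tangents_independent)
    show "n \<in> half_lattice"
      using n U by blast
  qed (use n s step distinct in auto)
  then show "inj v" and "independent (range v)"
    by blast+
qed

subsection \<open>Factorization\<close>

lemma factorizes_x:
  assumes U: "U \<subseteq> half_lattice"
    and step: "\<And>i m. m \<in> (\<lambda>n. n $ i) ` U \<Longrightarrow> m - 1 \<in> (\<lambda>n. n $ i) ` U \<Longrightarrow>
      u i (m - 1/4) \<noteq> u i (m - 3/4)"
  shows "factorizes U x"
proof -
  define i0 :: 'n where "i0 = undefined"
  \<comment> \<open>The normalizing constant is absorbed by the factor of an arbitrary index \<open>i0\<close>.\<close>
  define N where "N i k = (if i = i0 then 1 / normalizer k else 1)" for i k
  define g where "g i k m = f i k m * N i k" for i k m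
  have N: "N i k \<noteq> 0" for i k
    using normalizer_pos[of k] by (simp add: N_def)
  have "(\<Prod>i\<in>UNIV. N i k) = 1 / normalizer k" for k
    by (simp add: N_def)
  then have "x n $ k = (\<Prod>i\<in>UNIV. g i k (n $ i))" for n k
    by (simp add: x_nth g_def prod.distrib)
  moreover have "g i k m \<noteq> 0 \<and> (m - 1 \<in> (\<lambda>n. n $ i) ` U \<longrightarrow> g i k m - g i k (m - 1) \<noteq> 0)"
    if m: "m \<in> (\<lambda>n. n $ i) ` U" for i k m
  proof (intro conjI impI)
    have hm: "m \<in> half_ints"
      using m U half_lattice_nth by auto
    show "g i k m \<noteq> 0"
      using f_nonzero[OF hm] N by (simp add: g_def)
    assume m1: "m - 1 \<in> (\<lambda>n. n $ i) ` U"
    have "f i k (m - 1) * (u i (m - 1/4) + a k) = f i k m * (u i (m - 3/4) + a k)"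
      using f_full_step[OF hm, of "- 1" i k] by simp
    then have "f i k m \<noteq> f i k (m - 1)"
      using step[OF m m1] f_nonzero[OF hm, of i k] by auto
    then show "g i k m - g i k (m - 1) \<noteq> 0"
      using N by (simp add: g_def)
  qed
  ultimately show ?thesis
    unfolding factorizes_def by blast
qed

subsection \<open>Hyperoctants\<close>

lemma hyperoctant_imp_prod_rhs_pos:
  assumes n: "n \<in> half_lattice" and hyp: "in_one_hyperoctant x n"
  shows "0 < (\<Prod>j\<in>UNIV. rhs a j k (u j (n $ j + 1/4)))"
proof -
  obtain \<epsilon> :: "'n \<Rightarrow> real" where \<epsilon>: "\<epsilon> k \<in> {1, - 1}"
    and "0 \<le> \<epsilon> k * x n $ k" "0 \<le> \<epsilon> k * x (n + (1/2) *\<^sub>R 1) $ k"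
    using hyp unfolding in_one_hyperoctant_def hyperoctants_def by auto
  then have "0 \<le> x n $ k * x (n + (1/2) *\<^sub>R 1) $ k"
    by (auto intro: mult_nonneg_nonneg mult_nonpos_nonpos)
  moreover have "n + (1/2) *\<^sub>R 1 \<in> half_lattice"
    using n half_ints_step(1)[of _ 1] by (simp add: half_lattice_def)
  ultimately have "0 < x n $ k * x (n + (1/2) *\<^sub>R 1) $ k"
    using x_nonzero n by (simp add: order_less_le)
  then show ?thesis
    using x_half_step_rhs[OF n, of 1 k] normalizer_pos[of k] by (simp add: zero_less_divide_iff)
qed

lemma hyperoctant_imp_ex_bij:
  assumes "n \<in> half_lattice" and "in_one_hyperoctant x n"
  shows "\<exists>\<pi>. bij \<pi> \<and> (\<forall>i k. 0 < rhs a i k (u (\<pi> i) (n $ \<pi> i + 1/4)))"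
  using prod_rhs_pos_imp_ex_bij[of a "\<lambda>j. u j (n $ j + 1/4)"] a_decreasing
    rhs_nonzero[OF half_lattice_nth[OF assms(1)]] hyperoctant_imp_prod_rhs_pos[OF assms]
  by blast

lemma hyperoctant_imp_all_rhs_pos_sorted:
  assumes "n \<in> half_lattice" and "in_one_hyperoctant x n"
    and "\<And>i j. i < j \<Longrightarrow> u i (n $ i + 1/4) < u j (n $ j + 1/4)"
  shows "all_rhs_pos a u n"
  using hyperoctant_imp_ex_bij[OF assms(1,2)] assms(3)
    rhs_pos_of_bij_sorted[of _ a "\<lambda>j. u j (n $ j + 1/4)"]
  unfolding all_rhs_pos_def by blast

lemma all_rhs_pos_step:
  assumes "n' \<in> half_lattice" and "in_one_hyperoctant x n'"
    and "all_rhs_pos a u n" and "\<And>j. j \<noteq> l \<Longrightarrow> n' $ j = n $ j"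
  shows "all_rhs_pos a u n'"
proof -
  have "0 < rhs a j k (u j (n' $ j + 1/4))" if "j \<noteq> l" for j k
    using assms(3) assms(4)[OF that] by (simp add: all_rhs_pos_def)
  then show ?thesis
    using hyperoctant_imp_ex_bij[OF assms(1,2)]
      rhs_pos_of_bij_all_but_one[of _ a "\<lambda>j. u j (n' $ j + 1/4)"]
    unfolding all_rhs_pos_def by blast
qed

lemma all_rhs_pos_path:
  assumes path: "\<And>t. t \<le> T \<Longrightarrow> p t \<in> half_lattice \<and> in_one_hyperoctant x (p t)"
    and steps: "\<And>t. t < T \<Longrightarrow> \<exists>i. \<forall>j. j \<noteq> i \<longrightarrow> p (Suc t) $ j = p t $ j"
    and start: "all_rhs_pos a u (p 0)"
  shows "t \<le> T \<Longrightarrow> all_rhs_pos a u (p t)"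
proof (induction t)
  case 0
  then show ?case
    using start by simp
next
  case (Suc t)
  then obtain i where "\<And>j. j \<noteq> i \<Longrightarrow> p (Suc t) $ j = p t $ j"
    using steps[of t] by auto
  then show ?case
    using Suc path[of "Suc t"] all_rhs_pos_step[of "p (Suc t)" "p t" i] by simp
qed

subsection \<open>The net as a confocal coordinate system\<close>

lemma discrete_confocal_coordinate_system_x:
  assumes U: "U \<subseteq> half_lattice"
    and step: "\<And>i m. m \<in> (\<lambda>n. n $ i) ` U \<Longrightarrow> m - 1 \<in> (\<lambda>n. n $ i) ` U \<Longrightarrow>
      u i (m - 1/4) \<noteq> u i (m - 3/4)"
    and distinct: "\<And>n i j s t. n \<in> U \<Longrightarrow> s \<in> {1, - 1} \<Longrightarrow> t \<in> {1, - 1} \<Longrightarrow> i \<noteq> j \<Longrightarrow>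
      n + s *\<^sub>R axis i 1 \<in> U \<Longrightarrow> n + t *\<^sub>R axis j 1 \<in> U \<Longrightarrow>
      u i (n $ i + s / 4) \<noteq> u j (n $ j + t / 4)"
  shows "discrete_confocal_coordinate_system U x"
proof -
  have step': "u i (n $ i + 3 * s / 4) \<noteq> u i (n $ i + s / 4)"
    if n: "n \<in> U" and s: "s \<in> {1, - 1}" and n': "n + s *\<^sub>R axis i 1 \<in> U" for n i s
  proof -
    have m: "n $ i \<in> (\<lambda>n. n $ i) ` U" "n $ i + s \<in> (\<lambda>n. n $ i) ` U"
      using n imageI[OF n', of "\<lambda>n. n $ i"] by simp_all
    show ?thesis
    proof (cases "s = 1")
      case True
      then show ?thesis
        using step[of "n $ i + 1" i] m by (simp add: add.commute)
    next
      case False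
      then have "s = - 1"
        using s by simp
      then show ?thesis
        using step[of "n $ i" i] m by simp
    qed
  qed
  have "discrete_coordinate_system U x"
    using U step' distinct by (rule discrete_coordinate_system_x)
  moreover have "factorizes U x"
    using U step by (rule factorizes_x)
  moreover have "orthogonal_net U x"
  proof (rule orthogonal_net_x[OF U])
    show "u i (n $ i + 3/4) \<noteq> u i (n $ i + 1/4)" if "n \<in> U" "n + axis i 1 \<in> U" for n i
      using step'[of n 1 i] that by simp
  qed
  ultimately show ?thesis
    by (simp add: discrete_confocal_coordinate_system_def)
qed

end

section \<open>Discrete confocal coordinates from the difference equation\<close>

theorem theorem5p5:
  fixes a :: "'n :: {finite, linorder} \<Rightarrow> real"
    and u :: "'n \<Rightarrow> real \<Rightarrow> real"
  assumes a_decreasing: "\<And>i j. i < j \<Longrightarrow> a j < a i"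
    and a_pos: "\<And>i. 0 < a i"
    and rhs_nonzero: "\<And>i k m. m \<in> half_ints \<Longrightarrow> u i (m + 1/4) + a k \<noteq> 0"
  shows
    "(\<forall>i k. \<forall>m0\<in>half_ints. \<forall>c. c \<noteq> 0 \<longrightarrow>
        (\<exists>!h. h \<in> extensional half_ints \<and> solves a u i k h \<and> h m0 = c)) \<and>
     (\<forall>f. (\<forall>i k. solves a u i k (f i k)) \<longrightarrow>
        (\<forall>U. U \<subseteq> half_lattice \<and>
             (\<forall>i. \<forall>m \<in> (\<lambda>n. n $ i) ` U. m - 1 \<in> (\<lambda>n. n $ i) ` U \<longrightarrow>
                u i (m - 1/4) \<noteq> u i (m - 3/4)) \<and>
             (\<forall>n\<in>U. \<forall>i j. \<forall>s\<in>{1, - 1}. \<forall>t\<in>{1, - 1}.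
                i \<noteq> j \<and> n + s *\<^sub>R axis i 1 \<in> U \<and> n + t *\<^sub>R axis j 1 \<in> U \<longrightarrow>
                u i (n $ i + s/4) \<noteq> u j (n $ j + t/4)) \<longrightarrow>
             discrete_confocal_coordinate_system U (confocal_net a f)) \<and>
        (\<forall>n\<in>half_lattice. in_one_hyperoctant (confocal_net a f) n \<longrightarrow>
             (\<exists>\<pi>. bij \<pi> \<and> (\<forall>i k. 0 < rhs a i k (u (\<pi> i) (n $ \<pi> i + 1/4)))) \<and>
             ((\<forall>i j. i < j \<longrightarrow> u i (n $ i + 1/4) < u j (n $ j + 1/4)) \<longrightarrow> all_rhs_pos a u n)) \<and>
        (\<forall>(p :: nat \<Rightarrow> real ^ ('n :: {finite, linorder})) T.
             (\<forall>t\<le>T. p t \<in> half_lattice \<and> in_one_hyperoctant (confocal_net a f) (p t)) \<and>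
             (\<forall>t<T. \<exists>i. \<forall>j. j \<noteq> i \<longrightarrow> p (Suc t) $ j = p t $ j) \<and>
             all_rhs_pos a u (p 0) \<longrightarrow>
             (\<forall>t\<le>T. all_rhs_pos a u (p t))))"
proof (intro conjI allI ballI impI)
  fix i k and m0 c :: real
  assume m0: "m0 \<in> half_ints" and c: "c \<noteq> 0"
  have nz: "rhs a i k (u i (m + 1/4)) \<noteq> 0" if "m \<in> half_ints" for m
    using rhs_nonzero[OF that, of i k] by (simp add: rhs_def)
  show "\<exists>!h. h \<in> extensional half_ints \<and> solves a u i k h \<and> h m0 = c"
    unfolding solves_def
    using product_equation_ex1[of "\<lambda>m. rhs a i k (u i (m + 1/4))", OF nz m0 c] .
next
  fix f U
  assume f: "\<forall>i k. solves a u i k (f i k)"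
    and U: "U \<subseteq> half_lattice \<and>
             (\<forall>i. \<forall>m \<in> (\<lambda>n. n $ i) ` U. m - 1 \<in> (\<lambda>n. n $ i) ` U \<longrightarrow>
                u i (m - 1/4) \<noteq> u i (m - 3/4)) \<and>
             (\<forall>n\<in>U. \<forall>i j. \<forall>s\<in>{1, - 1}. \<forall>t\<in>{1, - 1}.
                i \<noteq> j \<and> n + s *\<^sub>R axis i 1 \<in> U \<and> n + t *\<^sub>R axis j 1 \<in> U \<longrightarrow>
                u i (n $ i + s/4) \<noteq> u j (n $ j + t/4))"
  interpret confocal_solution a u f
    by (rule confocal_solution.intro[OF a_decreasing rhs_nonzero f[rule_format]])
  note U_step = conjunct1[OF conjunct2[OF U]]
    and U_distinct = conjunct2[OF conjunct2[OF U]]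
  show "discrete_confocal_coordinate_system U (confocal_net a f)"
  proof (rule discrete_confocal_coordinate_system_x)
    show "U \<subseteq> half_lattice"
      by (rule conjunct1[OF U])
    show "u i (m - 1/4) \<noteq> u i (m - 3/4)"
      if "m \<in> (\<lambda>n. n $ i) ` U" "m - 1 \<in> (\<lambda>n. n $ i) ` U" for i m
      by (rule U_step[rule_format, OF that])
    show "u i (n $ i + s/4) \<noteq> u j (n $ j + t/4)"
      if "n \<in> U" "s \<in> {1, - 1}" "t \<in> {1, - 1}" "i \<noteq> j"
        "n + s *\<^sub>R axis i 1 \<in> U" "n + t *\<^sub>R axis j 1 \<in> U" for n i j s t
      by (rule U_distinct[rule_format, OF that(1-3)]) (intro conjI that)
  qed
next
  fix f and n :: "real ^ ('n :: {finite, linorder})"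
  assume f: "\<forall>i k. solves a u i k (f i k)"
    and n: "n \<in> half_lattice" "in_one_hyperoctant (confocal_net a f) n"
  interpret confocal_solution a u f
    by (rule confocal_solution.intro[OF a_decreasing rhs_nonzero f[rule_format]])
  show "\<exists>\<pi>. bij \<pi> \<and> (\<forall>i k. 0 < rhs a i k (u (\<pi> i) (n $ \<pi> i + 1/4)))"
    using hyperoctant_imp_ex_bij n by blast
  assume "\<forall>i j. i < j \<longrightarrow> u i (n $ i + 1/4) < u j (n $ j + 1/4)"
  then show "all_rhs_pos a u n"
    using hyperoctant_imp_all_rhs_pos_sorted n by blast
next
  fix f and p :: "nat \<Rightarrow> real ^ ('n :: {finite, linorder})" and T t
  assume f: "\<forall>i k. solves a u i k (f i k)"
    and p: "(\<forall>t\<le>T. p t \<in> half_lattice \<and> in_one_hyperoctant (confocal_net a f) (p t)) \<and>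
             (\<forall>t<T. \<exists>i. \<forall>j. j \<noteq> i \<longrightarrow> p (Suc t) $ j = p t $ j) \<and>
             all_rhs_pos a u (p 0)"
    and t: "t \<le> T"
  interpret confocal_solution a u f
    by (rule confocal_solution.intro[OF a_decreasing rhs_nonzero f[rule_format]])
  show "all_rhs_pos a u (p t)"
  proof (rule all_rhs_pos_path)
    show "all_rhs_pos a u (p 0)" "t \<le> T"
      using p t by blast+
  qed (use p in blast)+
qed

end
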